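(* Let $m,n \geq k \geq 1$ be integers. Given $A \in \mathbb{R}^{m \times n}$, the following statements are equivalent. (i) The matrix $A$ is totally positive of order $k$. (ii) For every $r \in \{1,\ldots,k\}$ and every contiguous $r\times r$ submatrix $A_r$ of $A$, defining the vector $$x^{A_r}:= (A^{11}_r,-A^{12}_r,\ldots , (-1)^{r-1}A^{1 r}_r)^T\in\mathbb{R}^r,$$ the matrix $A_r$ has the sign non-reversal property with respect to $x^{A_r}$.
   Context: A real matrix is totally positive of order $k$ ($TP_k$) if all its minors of order at most $k$ are positive. A contiguous submatrix is one whose row index set and column index set are each sets of consecutive integers. For an $r\times r$ matrix $A_r$, $A_r^{ij}$ denotes the determinant of the submatrix of $A_r$ obtained by deleting row $i$ and column $j$; if $r=1$, $A_1^{11}:=1$. A matrix $M\in\mathbb{R}^{r\times r}$ has the sign non-reversal property with respect to a set $S\subset\mathbb{R}^r$ if for all vectors $0\neq x\in S$ there exists a coordinate $i\in\{1,\ldots,r\}$ such that $x_i(Mx)_i>0$; with respect to a single vector $v$ means with respect to $S=\{v\}$. *)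

theory Defs
  imports
    Complex_Main
    "Jordan_Normal_Form.Determinant"
    "Jordan_Normal_Form.DL_Submatrix"
begin

text \<open>Rows, columns and coordinates are counted from \<open>0\<close>.\<close>

definition minors :: "nat \<Rightarrow> real mat \<Rightarrow> real set" where
  "minors r A = {det (submatrix A I J) | I J.
     I \<subseteq> {..<dim_row A} \<and> J \<subseteq> {..<dim_col A} \<and> card I = r \<and> card J = r}"

definition totally_positive :: "nat \<Rightarrow> real mat \<Rightarrow> bool" where
  "totally_positive k A \<longleftrightarrow> (\<forall>r\<in>{1..k}. \<forall>d\<in>minors r A. d > 0)"

definition consecutive :: "nat set \<Rightarrow> bool" where
  "consecutive I \<longleftrightarrow> (\<exists>a b. I = {a..<b})"

definition contiguous_submatrices :: "nat \<Rightarrow> real mat \<Rightarrow> real mat set" where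
  "contiguous_submatrices r A = {submatrix A I J | I J.
     I \<subseteq> {..<dim_row A} \<and> J \<subseteq> {..<dim_col A} \<and> card I = r \<and> card J = r \<and>
     consecutive I \<and> consecutive J}"

definition sign_non_reversal :: "real mat \<Rightarrow> real vec set \<Rightarrow> bool" where
  "sign_non_reversal M S \<longleftrightarrow>
     (\<forall>x\<in>S. x \<noteq> 0\<^sub>v (dim_row M) \<longrightarrow> (\<exists>i<dim_row M. x $ i * (M *\<^sub>v x) $ i > 0))"

text \<open>For a \<open>1 \<times> 1\<close> matrix, deleting row and column leaves the empty matrix. The convention
  that the corresponding minor is \<open>1\<close> is the value \<^const>\<open>det\<close> already has there.\<close>

lemma det_mat_delete_one:
  assumes "B \<in> carrier_mat 1 1"
  shows "det (mat_delete B 0 0) = 1"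
  using mat_delete_carrier[OF assms] by simp

definition alternating_minors_vec :: "real mat \<Rightarrow> real vec" where
  "alternating_minors_vec B = vec (dim_row B) (\<lambda>j. (-1) ^ j * det (mat_delete B 0 j))"

end

theory Submission
  imports Defs
begin

text \<open>The vector \<open>x\<close> attached to a square submatrix \<open>B\<close> is the first column of its adjugate, so
  \<open>B x = det B \<cdot> e\<^sub>1\<close>. By induction on the order the first entry of \<open>x\<close> is a positive contiguous
  minor, and sign non-reversal at \<open>x\<close> then says exactly that \<open>det B > 0\<close>. It remains to pass from
  contiguous to arbitrary minors, which is Fekete's theorem, applied first to rows and then to
  columns.\<close>

section \<open>Minors of a doubly indexed family and linear relations among its rows\<close>

text \<open>Taking entries from a function instead of a matrix turns selecting rows or columns into
  composition inside \<open>b\<close>, with no dimensions to carry along.\<close>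

definition leading_minor :: "nat \<Rightarrow> (nat \<Rightarrow> nat \<Rightarrow> real) \<Rightarrow> real" where
  "leading_minor q b = det (mat q q (\<lambda>(i, j). b i j))"

lemma leading_minor_cong:
  assumes "\<And>i j. i < q \<Longrightarrow> j < q \<Longrightarrow> b i j = c i j"
  shows "leading_minor q b = leading_minor q c"
  unfolding leading_minor_def by (rule arg_cong[where f = det]) (auto simp: assms)

lemma leading_minor_0 [simp]: "leading_minor 0 b = 1"
  unfolding leading_minor_def by (rule det_dim_zero) simp

lemma leading_minor_transpose: "leading_minor q (\<lambda>i j. b j i) = leading_minor q b"
proof -
  have "mat q q (\<lambda>(i, j). b j i) = transpose_mat (mat q q (\<lambda>(i, j). b i j))"
    by auto
  then show ?thesis
    unfolding leading_minor_def by (simp add: det_transpose[of _ q])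
qed

text \<open>Repeating column \<open>c\<close> in front of a
  \<open>(q + 1)\<close>-by-\<open>q\<close> array gives a singular square matrix; the sum is its
  Laplace expansion along the repeated column.\<close>

lemma alternating_cofactors_orthogonal:
  assumes "c < q"
  shows "(\<Sum>i<Suc q. (-1) ^ i * leading_minor q (\<lambda>k. b (insert_index i k)) * b i c) = 0"
proof -
  define M where "M = mat (Suc q) (Suc q) (\<lambda>(i, j). case j of 0 \<Rightarrow> b i c | Suc j' \<Rightarrow> b i j')"
  have M: "M \<in> carrier_mat (Suc q) (Suc q)"
    by (simp add: M_def)
  have "det (transpose_mat M) = 0"
    by (rule det_identical_rows[of _ "Suc q" 0 "Suc c"])
      (use assms in \<open>auto simp: M_def intro!: eq_vecI\<close>)
  then have "det M = 0"
    using det_transpose[OF M] by simp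
  moreover have "det M = (\<Sum>i<Suc q. M $$ (i, 0) * cofactor M i 0)"
    by (rule laplace_expansion_column[OF M]) simp
  moreover have "M $$ (i, 0) * cofactor M i 0
      = (-1) ^ i * leading_minor q (\<lambda>k. b (insert_index i k)) * b i c" if "i < Suc q" for i
  proof -
    have "mat_delete M i 0 = mat q q (\<lambda>(k, j). b (insert_index i k) j)"
      by (rule eq_matI) (auto simp: mat_delete_def M_def insert_index_def)
    then show ?thesis
      using that by (simp add: cofactor_def leading_minor_def M_def)
  qed
  ultimately show ?thesis
    by simp
qed

text \<open>The coefficients of a row dependency form a kernel vector of the transpose, whose
  determinant is the same nonzero number.\<close>

lemma row_dependency_trivial:
  assumes "leading_minor q b \<noteq> 0"
    and "\<And>c. c < q \<Longrightarrow> (\<Sum>i<q. u i * b i c) = 0"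
    and "i < q"
  shows "u i = 0"
proof -
  let ?M = "mat q q (\<lambda>(i, j). b j i)"
  have M: "?M \<in> carrier_mat q q"
    by simp
  have "det ?M \<noteq> 0"
    using assms(1) leading_minor_transpose[of q b] by (simp add: leading_minor_def)
  moreover have "?M *\<^sub>v vec q u = 0\<^sub>v q"
  proof (rule eq_vecI)
    fix c assume "c < dim_vec (0\<^sub>v q :: real vec)"
    then show "(?M *\<^sub>v vec q u) $ c = 0\<^sub>v q $ c"
      using assms(2)[of c] by (simp add: scalar_prod_def atLeast0LessThan mult.commute)
  qed simp
  ultimately have "vec q u = 0\<^sub>v q"
    unfolding det_0_iff_vec_prod_zero[OF M] using vec_carrier by blast
  then have "vec q u $ i = 0\<^sub>v q $ i"
    by simp
  then show ?thesis
    using assms(3) by simp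
qed

section \<open>Increasing selections of indices and Fekete's theorem\<close>

text \<open>Maps, unlike index sets, compose: a minor of a selected array is again a minor of the
  original one, and deleting row \<open>i\<close> is composition with
  \<open>insert_index i\<close>.\<close>

definition selects :: "nat \<Rightarrow> nat \<Rightarrow> (nat \<Rightarrow> nat) \<Rightarrow> bool" where
  "selects r N f \<longleftrightarrow> strict_mono_on {..<r} f \<and> (\<forall>i<r. f i < N)"

lemma selectsI:
  assumes "\<And>i j. i < j \<Longrightarrow> j < r \<Longrightarrow> f i < f j" and "\<And>i. i < r \<Longrightarrow> f i < N"
  shows "selects r N f"
  using assms unfolding selects_def by (auto intro!: strict_mono_onI)

lemma selects_less: "selects r N f \<Longrightarrow> i < j \<Longrightarrow> j < r \<Longrightarrow> f i < f j"
  unfolding selects_def using strict_mono_onD[of "{..<r}" f i j] by simp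

lemma selects_bound: "selects r N f \<Longrightarrow> i < r \<Longrightarrow> f i < N"
  unfolding selects_def by auto

lemma selects_mono: "selects r N f \<Longrightarrow> s \<le> r \<Longrightarrow> selects s N f"
  by (auto intro!: selectsI selects_less[of r N f] selects_bound[of r N f])

lemma selects_comp: "selects r N f \<Longrightarrow> selects q r g \<Longrightarrow> selects q N (\<lambda>i. f (g i))"
  by (rule selectsI) (simp_all add: selects_less selects_bound)

lemma selects_insert_index: "i \<le> q \<Longrightarrow> selects q (Suc q) (insert_index i)"
  by (auto intro!: selectsI simp: insert_index_def)

text \<open>The alternating vector of maximal minors of a \<open>(q + 2) \<times> (q + 1)\<close> matrix is a left kernel
  vector. Restricted to the first \<open>q\<close> columns the left kernel is two-dimensional, spanned by the
  cofactor vectors that omit the first and the last row. Comparing end coordinates shows that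
  both coefficients are positive.\<close>

lemma maximal_minor_pos_of_end_minors:
  assumes minors: "\<And>e. selects q (Suc (Suc q)) e \<Longrightarrow> leading_minor q (\<lambda>k. b (e k)) > 0"
    and first: "leading_minor (Suc q) (\<lambda>k. b (insert_index 0 k)) > 0"
    and last: "leading_minor (Suc q) (\<lambda>k. b (insert_index (Suc q) k)) > 0"
    and i: "i \<le> Suc q"
  shows "leading_minor (Suc q) (\<lambda>k. b (insert_index i k)) > 0"
proof (cases "i = 0 \<or> i = Suc q")
  case True
  then show ?thesis
    using first last by auto
next
  case False
  then obtain p where p: "i = Suc p" "p < q"
    using i by (cases i) auto
  \<comment> \<open>\<open>D i\<close> omits row \<open>i\<close> of all \<open>q + 2\<close> rows.
    In the first \<open>q\<close> columns, \<open>E i\<close> omits rows \<open>0\<close> and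
    \<open>Suc i\<close>, and \<open>F i\<close> omits rows \<open>i\<close> and
    \<open>Suc q\<close>.\<close>
  define D where "D i = leading_minor (Suc q) (\<lambda>k. b (insert_index i k))" for i
  define E where "E i = leading_minor q (\<lambda>k. b (Suc (insert_index i k)))" for i
  define F where "F i = leading_minor q (\<lambda>k. b (insert_index i k))" for i
  have E_pos: "E i > 0" and F_pos: "F i > 0" if "i \<le> q" for i
    unfolding E_def F_def using that
    by (auto intro!: minors selectsI simp: insert_index_def)
  \<comment> \<open>The vector of the \<open>E i\<close> has no entry at row \<open>0\<close> and
    that of the \<open>F i\<close> none at row \<open>Suc q\<close>, so the two end coordinates of
    \<open>D\<close> determine both coefficients.\<close>
  define \<alpha> where "\<alpha> = D (Suc q) / E q"
  define \<beta> where "\<beta> = D 0 / F 0"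
  have pos: "\<alpha> > 0" "\<beta> > 0"
    unfolding \<alpha>_def \<beta>_def using E_pos[of q] F_pos[of 0] first last by (auto simp: D_def)
  \<comment> \<open>What remains of the alternating vector of \<open>D\<close> on rows
    \<open>1\<close> to \<open>q\<close> after both multiples are removed; the end coordinates
    cancel.\<close>
  define u where "u j = (-1) ^ Suc j * (D (Suc j) - \<alpha> * E j - \<beta> * F (Suc j))" for j
  have sum0: "(\<Sum>j<q. u j * b (Suc j) c) = 0" if c: "c < q" for c
  proof -
    have D0: "D 0 * b 0 c - (\<Sum>j<q. (-1) ^ j * D (Suc j) * b (Suc j) c)
        - (-1) ^ q * D (Suc q) * b (Suc q) c = 0"
      using alternating_cofactors_orthogonal[of c "Suc q" b] c unfolding D_def[symmetric]
      unfolding sum.lessThan_Suc_shift[of _ "Suc q"] by (simp add: sum_negf)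
    have E0: "(\<Sum>j<q. (-1) ^ j * E j * b (Suc j) c) + (-1) ^ q * E q * b (Suc q) c = 0"
      using alternating_cofactors_orthogonal[OF c, of "\<lambda>k. b (Suc k)"] unfolding E_def[symmetric]
      by simp
    have F0: "F 0 * b 0 c - (\<Sum>j<q. (-1) ^ j * F (Suc j) * b (Suc j) c) = 0"
      using alternating_cofactors_orthogonal[OF c, of b] unfolding F_def[symmetric]
      unfolding sum.lessThan_Suc_shift by (simp add: sum_negf)
    have ends: "D 0 = \<beta> * F 0" "D (Suc q) = \<alpha> * E q"
      unfolding \<alpha>_def \<beta>_def using E_pos[of q] F_pos[of 0] by auto
    have "(\<Sum>j<q. u j * b (Suc j) c)
        = - (\<Sum>j<q. (-1) ^ j * D (Suc j) * b (Suc j) c)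
          + \<alpha> * (\<Sum>j<q. (-1) ^ j * E j * b (Suc j) c)
          + \<beta> * (\<Sum>j<q. (-1) ^ j * F (Suc j) * b (Suc j) c)"
      unfolding u_def sum_distrib_left sum_negf[symmetric] sum.distrib[symmetric]
      by (rule sum.cong) (auto simp: algebra_simps)
    also have "\<dots> = - (D 0 * b 0 c - (-1) ^ q * D (Suc q) * b (Suc q) c)
          + \<alpha> * (- ((-1) ^ q * E q * b (Suc q) c)) + \<beta> * (F 0 * b 0 c)"
      using D0 E0 F0 by (intro arg_cong2[where f = "(+)"] arg_cong2[where f = "(*)"]
          arg_cong[where f = uminus]) linarith+
    also have "\<dots> = 0"
      by (simp add: ends)
    finally show ?thesis .
  qed
  \<comment> \<open>Rows \<open>1\<close> to \<open>q\<close> form a nonsingular block in the first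
    \<open>q\<close> columns, so the remainder \<open>u\<close> vanishes.\<close>
  have "leading_minor q (\<lambda>k. b (Suc k)) > 0"
    by (rule minors) (auto intro!: selectsI)
  then have "u p = 0"
    using row_dependency_trivial[of q "\<lambda>k. b (Suc k)" u p] sum0 p by simp
  then have "D i = \<alpha> * E p + \<beta> * F i"
    by (simp add: u_def p)
  moreover have "\<dots> > 0"
    using pos E_pos[of p] F_pos[of i] p by (intro add_pos_pos mult_pos_pos) auto
  ultimately show ?thesis
    by (simp add: D_def)
qed

text \<open>Induction on the dispersion \<open>f q - f 0\<close>: inserting a missing row into a gap turns the minor
  into one of the inner minors of the preceding lemma, while its end minors are less dispersed.\<close>

lemma fekete:
  assumes minors: "\<And>e. selects q N e \<Longrightarrow> leading_minor q (\<lambda>k. a (e k)) > 0"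
    and contiguous: "\<And>s. s + Suc q \<le> N \<Longrightarrow> leading_minor (Suc q) (\<lambda>k. a (s + k)) > 0"
    and "selects (Suc q) N f"
  shows "leading_minor (Suc q) (\<lambda>k. a (f k)) > 0"
  using assms(3)
proof (induction "f q - f 0" arbitrary: f rule: less_induct)
  case less
  note f = less.prems
  show ?case
  proof (cases "\<exists>j<q. f (Suc j) \<noteq> Suc (f j)")
    case False
    have eq: "f i = f 0 + i" if "i \<le> q" for i
      using that by (induction i) (use False in auto)
    have "leading_minor (Suc q) (\<lambda>k. a (f k)) = leading_minor (Suc q) (\<lambda>k. a (f 0 + k))"
      by (rule leading_minor_cong) (metis eq less_Suc_eq_le)
    also have "\<dots> > 0"
      using contiguous[of "f 0"] selects_bound[OF f, of q] eq[of q] by simp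
    finally show ?thesis .
  next
    case True
    then obtain j where j: "j < q" and "f (Suc j) \<noteq> Suc (f j)"
      by blast
    then have gap: "Suc (f j) < f (Suc j)"
      using selects_less[OF f, of j "Suc j"] by simp
    \<comment> \<open>The missing row \<open>Suc (f j)\<close> is placed at position
      \<open>Suc j\<close>; deleting that position gives back \<open>f\<close>.\<close>
    define g where "g k = (if k \<le> j then f k else if k = Suc j then Suc (f j) else f (k - 1))" for k
    have g: "selects (Suc (Suc q)) N g"
    proof (rule selectsI)
      fix k l assume kl: "k < l" "l < Suc (Suc q)"
      have le: "f s \<le> f t" if "s \<le> t" "t < Suc q" for s t
        using that selects_less[OF f, of s t] by (cases "s = t") auto
      consider "l \<le> j" | "l = Suc j" | "k \<le> j" "l > Suc j" | "k = Suc j" "l > Suc j"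
        | "k > Suc j"
        using kl by linarith
      then show "g k < g l"
      proof cases
        case 1
        then show ?thesis using kl j selects_less[OF f, of k l] by (simp add: g_def)
      next
        case 2
        then show ?thesis using kl j le[of k j] by (simp add: g_def)
      next
        case 3
        then show ?thesis using kl selects_less[OF f, of k "l - 1"] by (simp add: g_def)
      next
        case 4
        then have "f (Suc j) \<le> f (l - 1)"
          using kl by (intro le) auto
        then show ?thesis using 4 gap by (simp add: g_def)
      next
        case 5
        then show ?thesis using kl selects_less[OF f, of "k - 1" "l - 1"] by (simp add: g_def)
      qed
    next
      fix k assume "k < Suc (Suc q)"
      then show "g k < N"
        using selects_bound[OF f, of k] selects_bound[OF f, of "k - 1"]
          selects_bound[OF f, of "Suc j"] gap j
        by (auto simp: g_def)
    qed
    have ends: "g 0 = f 0" "g (Suc q) = f q"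
      using j by (auto simp: g_def)
    have "leading_minor (Suc q) (\<lambda>k. a (g (insert_index (Suc j) k))) > 0"
    proof (rule maximal_minor_pos_of_end_minors)
      show "leading_minor q (\<lambda>k. a (g (e k))) > 0" if "selects q (Suc (Suc q)) e" for e
        by (rule minors) (rule selects_comp[OF g that])
      show "leading_minor (Suc q) (\<lambda>k. a (g (insert_index 0 k))) > 0"
      proof (rule less.hyps)
        \<comment> \<open>The last row stays and the first moves up; \<open>f 0 < f q\<close> keeps
          the inequality strict under truncated subtraction.\<close>
        show "g (insert_index 0 q) - g (insert_index 0 0) < f q - f 0"
          using selects_less[OF g, of 0 "Suc 0"] selects_less[OF f, of 0 q] ends j by simp
        show "selects (Suc q) N (\<lambda>k. g (insert_index 0 k))"
          by (rule selects_comp[OF g]) (rule selects_insert_index, simp)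
      qed
      show "leading_minor (Suc q) (\<lambda>k. a (g (insert_index (Suc q) k))) > 0"
      proof (rule less.hyps)
        show "g (insert_index (Suc q) q) - g (insert_index (Suc q) 0) < f q - f 0"
          using selects_less[OF g, of q "Suc q"] selects_less[OF g, of 0 q] ends j by simp
        show "selects (Suc q) N (\<lambda>k. g (insert_index (Suc q) k))"
          by (rule selects_comp[OF g]) (rule selects_insert_index, simp)
      qed
    qed (use j in simp)
    also have "leading_minor (Suc q) (\<lambda>k. a (g (insert_index (Suc j) k)))
        = leading_minor (Suc q) (\<lambda>k. a (f k))"
      by (rule leading_minor_cong) (auto simp: g_def insert_index_def)
    finally show ?thesis .
  qed
qed

section \<open>From contiguous to arbitrary minors\<close>

text \<open>Rows are freed first, with the columns kept consecutive. These minors are then the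
  contiguous case for freeing the columns, with rows and columns exchanged by transposition.\<close>

lemma minors_pos_of_contiguous_minors_pos:
  assumes contiguous: "\<And>r s t. r \<le> k \<Longrightarrow> s + r \<le> m \<Longrightarrow> t + r \<le> n \<Longrightarrow>
      leading_minor r (\<lambda>i j. a (s + i) (t + j)) > 0"
    and "r \<le> k" "selects r m f" "selects r n g"
  shows "leading_minor r (\<lambda>i j. a (f i) (g j)) > 0"
proof -
  have rows: "leading_minor r (\<lambda>i j. a (f i) (t + j)) > 0"
    if "r \<le> k" "selects r m f" "t + r \<le> n" for r f t
    using that
  proof (induction r arbitrary: f)
    case (Suc q)
    show ?case
      by (rule fekete[of q m "\<lambda>i j. a i (t + j)"]) (use Suc contiguous in auto)
  qed simp
  show ?thesis
    using assms(2-)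
  proof (induction r arbitrary: g)
    case (Suc q)
    have "leading_minor (Suc q) (\<lambda>j i. a (f i) (g j)) > 0"
    proof (rule fekete[of q n "\<lambda>j i. a (f i) j"])
      \<comment> \<open>The order drops for rows as well as columns: only the first \<open>q\<close>
        rows chosen by \<open>f\<close> enter here.\<close>
      show "leading_minor q (\<lambda>j i. a (f i) (e j)) > 0" if "selects q n e" for e
        using Suc.IH[OF _ _ that] Suc.prems selects_mono[of "Suc q" m f q]
        by (simp add: leading_minor_transpose[of q "\<lambda>i j. a (f i) (e j)"])
      show "leading_minor (Suc q) (\<lambda>j i. a (f i) (t + j)) > 0" if "t + Suc q \<le> n" for t
        using rows[OF Suc.prems(1,2) that]
        by (simp add: leading_minor_transpose[of "Suc q" "\<lambda>i j. a (f i) (t + j)"])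
    qed (use Suc.prems in simp)
    then show ?case
      by (simp add: leading_minor_transpose[of "Suc q" "\<lambda>i j. a (f i) (g j)"])
  qed simp
qed

section \<open>Sign non-reversal at the vector of alternating minors\<close>

lemma mult_alternating_minors_vec:
  assumes B: "B \<in> carrier_mat r r" and i: "i < r"
  shows "(B *\<^sub>v alternating_minors_vec B) $ i = (if i = 0 then det B else 0)"
proof -
  have "alternating_minors_vec B = col (adj_mat B) 0"
    using B i by (auto simp: alternating_minors_vec_def adj_mat_def cofactor_def intro!: eq_vecI)
  then have "(B *\<^sub>v alternating_minors_vec B) $ i = (B * adj_mat B) $$ (i, 0)"
    using B i adj_mat(1)[OF B] by simp
  also have "\<dots> = (if i = 0 then det B else 0)"
    using i by (simp add: adj_mat(2)[OF B])
  finally show ?thesis .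
qed

text \<open>The positive entry at coordinate \<open>0\<close> makes the vector nonzero. All other
  coordinates of the product vanish, so coordinate \<open>0\<close> is the only possible
  witness.\<close>

lemma sign_non_reversal_alternating_minors_vec:
  assumes B: "B \<in> carrier_mat r r" and "0 < r" and pos: "det (mat_delete B 0 0) > 0"
  shows "sign_non_reversal B {alternating_minors_vec B} \<longleftrightarrow> det B > 0"
proof -
  let ?x = "alternating_minors_vec B"
  have x0: "?x $ 0 = det (mat_delete B 0 0)"
    using assms by (simp add: alternating_minors_vec_def)
  then have "?x \<noteq> 0\<^sub>v r"
    using assms by auto
  then have "sign_non_reversal B {?x} \<longleftrightarrow> (\<exists>i<r. ?x $ i * (B *\<^sub>v ?x) $ i > 0)"
    using B by (auto simp: sign_non_reversal_def)
  also have "\<dots> \<longleftrightarrow> ?x $ 0 * det B > 0"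
    using mult_alternating_minors_vec[OF B] \<open>0 < r\<close> by (auto split: if_splits)
  also have "\<dots> \<longleftrightarrow> det B > 0"
    using pos by (simp add: x0 zero_less_mult_iff)
  finally show ?thesis .
qed

section \<open>Submatrices given by index sets, rewritten through selections\<close>

lemma pick_atLeastLessThan: "i < r \<Longrightarrow> pick {s..<s + r} i = s + i"
proof -
  assume "i < r"
  then have "{a \<in> {s..<s + r}. a < s + i} = {s..<s + i}"
    by auto
  then show ?thesis
    using pick_card_in_set[of "s + i" "{s..<s + r}"] \<open>i < r\<close> by simp
qed

lemma submatrix_subset:
  assumes "I \<subseteq> {..<dim_row A}" "J \<subseteq> {..<dim_col A}"
  shows "submatrix A I J = mat (card I) (card J) (\<lambda>(i, j). A $$ (pick I i, pick J j))"
proof -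
  have "{i. i < dim_row A \<and> i \<in> I} = I" "{j. j < dim_col A \<and> j \<in> J} = J"
    using assms by auto
  then show ?thesis
    by (simp add: submatrix_def)
qed

lemma submatrix_atLeastLessThan:
  assumes "s + r \<le> dim_row A" "t + r \<le> dim_col A"
  shows "submatrix A {s..<s + r} {t..<t + r} = mat r r (\<lambda>(i, j). A $$ (s + i, t + j))"
  using assms by (subst submatrix_subset) (auto simp: pick_atLeastLessThan)

lemma selects_pick:
  assumes "I \<subseteq> {..<N}" "card I = r"
  shows "selects r N (pick I)"
  using assms pick_in_set_le[of _ I] by (auto intro!: selectsI pick_mono_le)

lemma contiguous_submatrices_eq:
  assumes "0 < r"
  shows "contiguous_submatrices r A = {mat r r (\<lambda>(i, j). A $$ (s + i, t + j)) | s t.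
    s + r \<le> dim_row A \<and> t + r \<le> dim_col A}" (is "_ = ?R")
proof (intro equalityI subsetI)
  fix B assume "B \<in> contiguous_submatrices r A"
  then obtain s s' t t' where *: "B = submatrix A {s..<s'} {t..<t'}" "{s..<s'} \<subseteq> {..<dim_row A}"
      "{t..<t'} \<subseteq> {..<dim_col A}" "card {s..<s'} = r" "card {t..<t'} = r"
    unfolding contiguous_submatrices_def consecutive_def by blast
  \<comment> \<open>Positive cardinality matters here: an empty interval could be written with
    \<open>s' < s\<close>.\<close>
  then have st: "s' = s + r" "t' = t + r"
    using assms by auto
  moreover have "s + r \<le> dim_row A" "t + r \<le> dim_col A"
    using *(2,3) assms by (simp_all add: st ivl_subset lessThan_atLeast0)
  ultimately show "B \<in> ?R"
    using * submatrix_atLeastLessThan by blast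
next
  fix B assume "B \<in> ?R"
  then obtain s t where *: "B = mat r r (\<lambda>(i, j). A $$ (s + i, t + j))"
    "s + r \<le> dim_row A" "t + r \<le> dim_col A"
    by blast
  then have "B = submatrix A {s..<s + r} {t..<t + r}"
    using submatrix_atLeastLessThan[of s r A t] by simp
  moreover have "{s..<s + r} \<subseteq> {..<dim_row A}" "{t..<t + r} \<subseteq> {..<dim_col A}"
    using * by auto
  ultimately show "B \<in> contiguous_submatrices r A"
    unfolding contiguous_submatrices_def consecutive_def
    by (intro CollectI exI[of _ "{s..<s + r}"] exI[of _ "{t..<t + r}"]) auto
qed

lemma totally_positive_iff_contiguous:
  "totally_positive k A \<longleftrightarrow> (\<forall>r s t. r \<le> k \<longrightarrow> s + r \<le> dim_row A \<longrightarrow> t + r \<le> dim_col A \<longrightarrow>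
     leading_minor r (\<lambda>i j. A $$ (s + i, t + j)) > 0)" (is "_ \<longleftrightarrow> ?R")
proof
  assume tp: "totally_positive k A"
  show ?R
  proof (intro allI impI)
    fix r s t assume *: "r \<le> k" "s + r \<le> dim_row A" "t + r \<le> dim_col A"
    show "leading_minor r (\<lambda>i j. A $$ (s + i, t + j)) > 0"
    proof (cases "r = 0")
      case False
      have "{s..<s + r} \<subseteq> {..<dim_row A}" "{t..<t + r} \<subseteq> {..<dim_col A}"
        using * by auto
      then have "det (submatrix A {s..<s + r} {t..<t + r}) \<in> minors r A"
        unfolding minors_def by force
      then show ?thesis
        using tp False * unfolding totally_positive_def
        by (auto simp: submatrix_atLeastLessThan leading_minor_def)
    qed simp
  qed
next
  assume R: ?R
  show "totally_positive k A"
    unfolding totally_positive_def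
  proof (intro ballI)
    fix r d assume r: "r \<in> {1..k}" and "d \<in> minors r A"
    then obtain I J where *: "d = det (submatrix A I J)" "I \<subseteq> {..<dim_row A}" "J \<subseteq> {..<dim_col A}"
      "card I = r" "card J = r"
      unfolding minors_def by blast
    have "leading_minor r (\<lambda>i j. A $$ (pick I i, pick J j)) > 0"
      by (rule minors_pos_of_contiguous_minors_pos[of k "dim_row A" "dim_col A" "\<lambda>i j. A $$ (i, j)"])
        (use R r * in \<open>auto intro: selects_pick\<close>)
    then show "d > 0"
      using * by (simp add: submatrix_subset leading_minor_def)
  qed
qed

theorem theorem3:
  fixes A :: "real mat" and m n k :: nat
  assumes "1 \<le> k" and "k \<le> m" and "k \<le> n"
    and "A \<in> carrier_mat m n"
  shows "totally_positive k A \<longleftrightarrow>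
    (\<forall>r\<in>{1..k}. \<forall>B\<in>contiguous_submatrices r A.
       sign_non_reversal B {alternating_minors_vec B})"
proof -
  define B where "B r s t = mat r r (\<lambda>(i, j). A $$ (s + i, t + j))" for r s t
  define P where "P r s t \<longleftrightarrow> s + r \<le> dim_row A \<and> t + r \<le> dim_col A" for r s t
  \<comment> \<open>Deleting the first row and column of the block at \<open>(s, t)\<close> leaves
    the contiguous block at \<open>(Suc s, Suc t)\<close>, of order one less.\<close>
  have snr: "sign_non_reversal (B (Suc r) s t) {alternating_minors_vec (B (Suc r) s t)}
      \<longleftrightarrow> det (B (Suc r) s t) > 0" if "det (B r (Suc s) (Suc t)) > 0" for r s t
  proof (rule sign_non_reversal_alternating_minors_vec)
    have "mat_delete (B (Suc r) s t) 0 0 = B r (Suc s) (Suc t)"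
      by (rule eq_matI) (auto simp: B_def mat_delete_def)
    then show "det (mat_delete (B (Suc r) s t) 0 0) > 0"
      using that by simp
  qed (auto simp: B_def)
  have "totally_positive k A \<longleftrightarrow> (\<forall>r s t. r \<le> k \<longrightarrow> P r s t \<longrightarrow> det (B r s t) > 0)"
    unfolding totally_positive_iff_contiguous leading_minor_def B_def P_def by blast
  also have "\<dots> \<longleftrightarrow> (\<forall>r\<in>{1..k}. \<forall>s t. P r s t \<longrightarrow>
      sign_non_reversal (B r s t) {alternating_minors_vec (B r s t)})"
  proof
    assume pos: "\<forall>r s t. r \<le> k \<longrightarrow> P r s t \<longrightarrow> det (B r s t) > 0"
    show "\<forall>r\<in>{1..k}. \<forall>s t. P r s t \<longrightarrow>
      sign_non_reversal (B r s t) {alternating_minors_vec (B r s t)}"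
    proof (intro ballI allI impI)
      fix r s t assume "r \<in> {1..k}" "P r s t"
      then obtain q where "r = Suc q" "P q (Suc s) (Suc t)"
        by (cases r) (auto simp: P_def)
      then show "sign_non_reversal (B r s t) {alternating_minors_vec (B r s t)}"
        using pos snr \<open>r \<in> {1..k}\<close> \<open>P r s t\<close> by simp
    qed
  next
    assume hyp: "\<forall>r\<in>{1..k}. \<forall>s t. P r s t \<longrightarrow>
      sign_non_reversal (B r s t) {alternating_minors_vec (B r s t)}"
    have "det (B r s t) > 0" if "r \<le> k" "P r s t" for r s t
      using that
    \<comment> \<open>The position must vary because the smaller block starts one step down and
      right. The base case is the empty determinant \<open>1\<close>, the convention for order
      one.\<close>
    proof (induction r arbitrary: s t)
      case 0
      then show ?case
        by (simp add: B_def)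
    next
      case (Suc r)
      have "det (B r (Suc s) (Suc t)) > 0"
        by (rule Suc.IH) (use Suc.prems in \<open>auto simp: P_def\<close>)
      moreover have "Suc r \<in> {1..k}"
        using Suc.prems by simp
      ultimately show ?case
        using snr hyp Suc.prems by blast
    qed
    then show "\<forall>r s t. r \<le> k \<longrightarrow> P r s t \<longrightarrow> det (B r s t) > 0"
      by blast
  qed
  also have "\<dots> \<longleftrightarrow> (\<forall>r\<in>{1..k}. \<forall>C\<in>contiguous_submatrices r A.
       sign_non_reversal C {alternating_minors_vec C})"
    by (rule ball_cong[OF refl]) (auto simp: contiguous_submatrices_eq B_def P_def)
  finally show ?thesis .
qed

end
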